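(* Let $L=Fx+H$ be a finite dimensional Lie algebra over an algebraically closed field $F$ of characteristic $p>0$, where $x\in L$ and $H$ is a codimension one ideal in $L$. Let $\lambda: H\to F$ be a weight of $U(H)$, that is, a linear form with $U(H)_\lambda\neq 0$. Then $\lambda([L,L])=0$ if and only if $U(H)_\lambda$ is $\mathrm{ad}x$ stable.
   Context: $U(H)$ is the enveloping algebra of $H$, regarded as a subalgebra of the enveloping algebra $U(L)$ of $L$. For a linear form $\lambda:H\to F$, $U(H)_\lambda=\{u\in U(H) : [h,u]=\lambda(h)u \text{ for all } h\in H\}$. A subspace $W\subseteq U(H)$ is called $\mathrm{ad}x$ stable if $[x,W]\subseteq W$, where the bracket is the commutator in $U(L)$. Note that $[L,L]\subseteq H$, since $L=Fx+H$ with $H$ an ideal. *)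

theory Defs
  imports
    "HOL-Computational_Algebra.Polynomial"
    "HOL-Library.Poly_Mapping"
    "HOL-Algebra.QuotRing"
begin

(* Words form the free monoid, written additively because HOL-Library.Poly_Mapping multiplies
   by convolution along (+) on the index type. Hence 'l word =>0 'k is the free associative
   unital 'k-algebra on the set of all elements of 'l. *)

datatype 'l word = Word (letters: "'l list")

instantiation word :: (type) monoid_add
begin

definition zero_word :: "'a word" where "0 = Word []"

definition plus_word :: "'a word \<Rightarrow> 'a word \<Rightarrow> 'a word"
  where "v + w = Word (letters v @ letters w)"

instance by standard (auto simp: zero_word_def plus_word_def)

end

definition free_alg :: "'l set \<Rightarrow> ('l word \<Rightarrow>\<^sub>0 'k::field) ring" where
  "free_alg G =
    \<lparr>carrier = {a. \<forall>w\<in>Poly_Mapping.keys a. set (letters w) \<subseteq> G},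
     mult = (*), one = 1, zero = 0, add = (+)\<rparr>"

definition gen :: "'l \<Rightarrow> 'l word \<Rightarrow>\<^sub>0 'k::field" where
  "gen a = Poly_Mapping.single (Word [a]) 1"

definition scalar :: "'k::field \<Rightarrow> 'l word \<Rightarrow>\<^sub>0 'k" where
  "scalar c = Poly_Mapping.single 0 c"

(* The Lie algebra L is the whole type 'l; H below is a subset of it. *)

locale lie_algebra = vector_space scale
  for scale :: "'k::field \<Rightarrow> 'l::ab_group_add \<Rightarrow> 'l" +
  fixes bracket :: "'l \<Rightarrow> 'l \<Rightarrow> 'l"
  assumes bracket_add_left: "bracket (a + b) c = bracket a c + bracket b c"
    and bracket_add_right: "bracket a (b + c) = bracket a b + bracket a c"
    and bracket_scale_left: "bracket (scale r a) b = scale r (bracket a b)"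
    and bracket_scale_right: "bracket a (scale r b) = scale r (bracket a b)"
    and bracket_self: "bracket a a = 0"
    and jacobi: "bracket a (bracket b c) + bracket b (bracket c a) + bracket c (bracket a b) = 0"
begin

definition lie_ideal :: "'l set \<Rightarrow> bool" where
  "lie_ideal H \<longleftrightarrow> subspace H \<and> (\<forall>a. \<forall>h\<in>H. bracket a h \<in> H)"

definition derived_algebra :: "'l set" where
  "derived_algebra = span {bracket a b | a b. True}"

definition linear_form_on :: "'l set \<Rightarrow> ('l \<Rightarrow> 'k) \<Rightarrow> bool" where
  "linear_form_on H lam \<longleftrightarrow>
    (\<forall>a\<in>H. \<forall>b\<in>H. lam (a + b) = lam a + lam b) \<and>
    (\<forall>r. \<forall>a\<in>H. lam (scale r a) = r * lam a)"

(* For a Lie subalgebra G, env_alg G is the enveloping algebra U(G): the tensor algebra of G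
   modulo the elements a b - b a - [a,b]. The tensor algebra is itself the free algebra on the
   set G modulo the first two families of relations, and both quotients are taken at once. *)

definition env_rels :: "'l set \<Rightarrow> ('l word \<Rightarrow>\<^sub>0 'k) set" where
  "env_rels G =
    {gen (a + b) - gen a - gen b | a b. a \<in> G \<and> b \<in> G} \<union>
    {gen (scale r a) - scalar r * gen a | r a. a \<in> G} \<union>
    {gen a * gen b - gen b * gen a - gen (bracket a b) | a b. a \<in> G \<and> b \<in> G}"

definition env_ideal :: "'l set \<Rightarrow> ('l word \<Rightarrow>\<^sub>0 'k) set" where
  "env_ideal G = Idl\<^bsub>free_alg G\<^esub> (env_rels G)"

definition env_alg :: "'l set \<Rightarrow> ('l word \<Rightarrow>\<^sub>0 'k) set ring" where
  "env_alg G = free_alg G Quot env_ideal G"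

definition env_proj :: "('l word \<Rightarrow>\<^sub>0 'k) \<Rightarrow> ('l word \<Rightarrow>\<^sub>0 'k) set" where
  "env_proj a = env_ideal UNIV +>\<^bsub>free_alg UNIV\<^esub> a"

definition env_incl :: "'l \<Rightarrow> ('l word \<Rightarrow>\<^sub>0 'k) set" where
  "env_incl a = env_proj (gen a)"

definition env_scale ::
    "'k \<Rightarrow> ('l word \<Rightarrow>\<^sub>0 'k) set \<Rightarrow> ('l word \<Rightarrow>\<^sub>0 'k) set" where
  "env_scale r u = env_proj (scalar r) \<otimes>\<^bsub>env_alg UNIV\<^esub> u"

definition env_commutator ::
    "('l word \<Rightarrow>\<^sub>0 'k) set \<Rightarrow> ('l word \<Rightarrow>\<^sub>0 'k) set \<Rightarrow> ('l word \<Rightarrow>\<^sub>0 'k) set" where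
  "env_commutator u v =
    (u \<otimes>\<^bsub>env_alg UNIV\<^esub> v) \<ominus>\<^bsub>env_alg UNIV\<^esub> (v \<otimes>\<^bsub>env_alg UNIV\<^esub> u)"

(* The canonical homomorphism U(H) -> U(L), sending a + env_ideal H to a + env_ideal UNIV
   (see env_map_coset). It is injective by the Poincare-Birkhoff-Witt theorem, so its image
   env_sub H is U(H) regarded as a subalgebra of U(L). *)

definition env_map :: "('l word \<Rightarrow>\<^sub>0 'k) set \<Rightarrow> ('l word \<Rightarrow>\<^sub>0 'k) set" where
  "env_map C = env_ideal UNIV <+>\<^bsub>free_alg UNIV\<^esub> C"

definition env_sub :: "'l set \<Rightarrow> ('l word \<Rightarrow>\<^sub>0 'k) set set" where
  "env_sub H = env_map ` carrier (env_alg H)"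

definition weight_space :: "'l set \<Rightarrow> ('l \<Rightarrow> 'k) \<Rightarrow> ('l word \<Rightarrow>\<^sub>0 'k) set set" where
  "weight_space H lam =
    {u \<in> env_sub H. \<forall>h\<in>H. env_commutator (env_incl h) u = env_scale (lam h) u}"

definition ad_stable :: "'l \<Rightarrow> ('l word \<Rightarrow>\<^sub>0 'k) set set \<Rightarrow> bool" where
  "ad_stable x W \<longleftrightarrow> (\<forall>w\<in>W. env_commutator (env_incl x) w \<in> W)"

end

lemma letters_plus [simp]: "letters (v + w) = letters v @ letters w"
  by (simp add: plus_word_def)

lemma letters_zero [simp]: "letters 0 = []"
  by (simp add: zero_word_def)

lemma abelian_group_free_alg:
  "abelian_group (free_alg G :: ('l word \<Rightarrow>\<^sub>0 'k::field) ring)"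
proof (rule abelian_groupI)
  let ?R = "free_alg G :: ('l word \<Rightarrow>\<^sub>0 'k) ring"
  show "a \<oplus>\<^bsub>?R\<^esub> b \<in> carrier ?R" if "a \<in> carrier ?R" "b \<in> carrier ?R" for a b
    using that Poly_Mapping.keys_add[of a b] by (auto simp: free_alg_def)
  show "\<exists>y\<in>carrier ?R. y \<oplus>\<^bsub>?R\<^esub> a = \<zero>\<^bsub>?R\<^esub>" if "a \<in> carrier ?R" for a
    using that by (intro bexI[of _ "- a"]) (simp_all add: free_alg_def)
qed (simp_all add: free_alg_def ac_simps)

lemma mult_in_free_alg:
  assumes "a \<in> carrier (free_alg G)" "b \<in> carrier (free_alg G)"
  shows "a * b \<in> carrier (free_alg G)"
proof -
  have "set (letters w) \<subseteq> G" if w: "w \<in> Poly_Mapping.keys (a * b)" for w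
  proof -
    obtain u v where "w = u + v" "u \<in> Poly_Mapping.keys a" "v \<in> Poly_Mapping.keys b"
      using w keys_mult[of a b] by blast
    then show ?thesis
      using assms by (simp add: free_alg_def)
  qed
  then show ?thesis
    by (simp add: free_alg_def)
qed

lemma monoid_free_alg: "Group.monoid (free_alg G :: ('l word \<Rightarrow>\<^sub>0 'k::field) ring)"
proof (rule Group.monoidI)
  let ?R = "free_alg G :: ('l word \<Rightarrow>\<^sub>0 'k) ring"
  show "a \<otimes>\<^bsub>?R\<^esub> b \<in> carrier ?R" if "a \<in> carrier ?R" "b \<in> carrier ?R" for a b
    using mult_in_free_alg[OF that] by (simp add: free_alg_def)
qed (simp_all add: free_alg_def mult.assoc)

lemma ring_free_alg: "ring (free_alg G :: ('l word \<Rightarrow>\<^sub>0 'k::field) ring)"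
  by (rule ringI[OF abelian_group_free_alg monoid_free_alg])
     (simp_all add: free_alg_def distrib_left distrib_right)

lemma minus_in_free_alg:
  "a \<in> carrier (free_alg G) \<Longrightarrow> b \<in> carrier (free_alg G) \<Longrightarrow> a - b \<in> carrier (free_alg G)"
  using keys_diff[of a b] by (auto simp: free_alg_def)

lemma gen_in_free_alg: "a \<in> G \<Longrightarrow> gen a \<in> carrier (free_alg G)"
  by (simp add: free_alg_def gen_def)

lemma scalar_in_free_alg: "scalar r \<in> carrier (free_alg G)"
  by (simp add: free_alg_def scalar_def)

context lie_algebra
begin

lemma env_rels_in_free_alg:
  assumes "subspace G" "\<And>a b. a \<in> G \<Longrightarrow> b \<in> G \<Longrightarrow> bracket a b \<in> G"
  shows "env_rels G \<subseteq> carrier (free_alg G)"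
proof -
  have "a + b \<in> G" if "a \<in> G" "b \<in> G" for a b
    using assms(1) that by (auto simp: subspace_def)
  moreover have "scale r a \<in> G" if "a \<in> G" for a r
    using assms(1) that by (auto simp: subspace_def)
  ultimately show ?thesis
    using assms(2)
    by (auto simp: env_rels_def intro!: minus_in_free_alg mult_in_free_alg gen_in_free_alg
        scalar_in_free_alg)
qed

lemma ideal_env_ideal:
  assumes "subspace G" "\<And>a b. a \<in> G \<Longrightarrow> b \<in> G \<Longrightarrow> bracket a b \<in> G"
  shows "ideal (env_ideal G) (free_alg G)"
  unfolding env_ideal_def
  by (intro ring.genideal_ideal[OF ring_free_alg] env_rels_in_free_alg assms)

lemma ideal_env_ideal_UNIV: "ideal (env_ideal UNIV) (free_alg UNIV)"
  by (rule ideal_env_ideal) auto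

lemma env_ideal_mono:
  assumes "subspace G" "\<And>a b. a \<in> G \<Longrightarrow> b \<in> G \<Longrightarrow> bracket a b \<in> G"
  shows "env_ideal G \<subseteq> env_ideal UNIV"
proof
  fix a assume "a \<in> env_ideal G"
  have carr: "carrier (free_alg UNIV :: ('l word \<Rightarrow>\<^sub>0 'k) ring) = UNIV"
    by (simp add: free_alg_def)
  interpret U: ideal "env_ideal UNIV" "free_alg UNIV" by (rule ideal_env_ideal_UNIV)
  interpret G: ring "free_alg G :: ('l word \<Rightarrow>\<^sub>0 'k) ring" by (rule ring_free_alg)
  let ?J = "env_ideal UNIV \<inter> carrier (free_alg G)"
  have inv: "\<ominus>\<^bsub>free_alg G\<^esub> b = - b" if "b \<in> carrier (free_alg G)" for b :: "'l word \<Rightarrow>\<^sub>0 'k" and G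
    using that minus_in_free_alg[of 0 G b]
    by (intro abelian_group.minus_equality[OF ring.is_abelian_group[OF ring_free_alg]])
       (auto simp: free_alg_def)
  have "ideal ?J (free_alg G)"
  proof (rule idealI)
    show "subgroup ?J (add_monoid (free_alg G))"
    proof (rule G.add.subgroupI)
      have "0 \<in> ?J"
        using additive_subgroup.zero_closed[OF U.is_additive_subgroup] by (simp add: free_alg_def)
      then show "?J \<noteq> {}" by blast
      show "\<ominus>\<^bsub>free_alg G\<^esub> b \<in> ?J" if "b \<in> ?J" for b
        using that inv[of b G] inv[of b UNIV] carr additive_subgroup.a_inv_closed[OF U.is_additive_subgroup, of b]
          G.a_inv_closed[of b] by auto
      show "b \<oplus>\<^bsub>free_alg G\<^esub> c \<in> ?J" if "b \<in> ?J" "c \<in> ?J" for b c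
        using that additive_subgroup.a_closed[OF U.is_additive_subgroup, of b c]
          G.a_closed[of b c] by (auto simp: free_alg_def)
    qed auto
    show "b \<otimes>\<^bsub>free_alg G\<^esub> a \<in> ?J" if "a \<in> ?J" "b \<in> carrier (free_alg G)" for a b
      using that U.I_l_closed[of a b] G.m_closed[of b a] carr by (auto simp: free_alg_def)
    show "a \<otimes>\<^bsub>free_alg G\<^esub> b \<in> ?J" if "a \<in> ?J" "b \<in> carrier (free_alg G)" for a b
      using that U.I_r_closed[of a b] G.m_closed[of a b] carr by (auto simp: free_alg_def)
  qed (rule ring_free_alg)
  moreover have "env_rels G \<subseteq> ?J"
  proof -
    have "env_rels G \<subseteq> env_rels UNIV"
      unfolding env_rels_def by blast
    also have "\<dots> \<subseteq> env_ideal UNIV"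
      unfolding env_ideal_def
      by (intro ring.genideal_self[OF ring_free_alg] env_rels_in_free_alg) auto
    finally show ?thesis
      using env_rels_in_free_alg[OF assms] by blast
  qed
  ultimately show "a \<in> env_ideal UNIV"
    using \<open>a \<in> env_ideal G\<close> unfolding env_ideal_def[of G] genideal_def by blast
qed

lemma env_map_coset:
  assumes "subspace H" "\<And>a b. a \<in> H \<Longrightarrow> b \<in> H \<Longrightarrow> bracket a b \<in> H"
  shows "env_map (env_ideal H +>\<^bsub>free_alg H\<^esub> a) = env_proj a"
proof -
  interpret I: ideal "env_ideal UNIV" "free_alg UNIV" by (rule ideal_env_ideal_UNIV)
  interpret J: ideal "env_ideal H" "free_alg H" by (rule ideal_env_ideal[OF assms])
  have J0: "0 \<in> env_ideal H"
    using additive_subgroup.zero_closed[OF J.is_additive_subgroup] by (simp add: free_alg_def)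
  have add: "i + j \<in> env_ideal UNIV" if "i \<in> env_ideal UNIV" "j \<in> env_ideal H" for i j
    using additive_subgroup.a_closed[OF I.is_additive_subgroup, of i j] env_ideal_mono[OF assms] that by (auto simp: free_alg_def)
  show ?thesis
  proof (intro equalityI subsetI)
    fix z assume "z \<in> env_map (env_ideal H +>\<^bsub>free_alg H\<^esub> a)"
    then obtain i j where "i \<in> env_ideal UNIV" "j \<in> env_ideal H" "z = i + (j + a)"
      by (auto simp: env_map_def set_add_def' a_r_coset_def' free_alg_def)
    then show "z \<in> env_proj a"
      using add[of i j]
      by (auto simp: env_proj_def a_r_coset_def' free_alg_def add.assoc intro!: bexI[of _ "i + j"])
  next
    fix z assume "z \<in> env_proj a"
    then obtain i where "i \<in> env_ideal UNIV" "z = i + (0 + a)"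
      by (auto simp: env_proj_def a_r_coset_def' free_alg_def)
    then show "z \<in> env_map (env_ideal H +>\<^bsub>free_alg H\<^esub> a)"
      using J0 unfolding env_map_def set_add_def' a_r_coset_def'
      by (auto simp: free_alg_def) (metis add_0_right)
  qed
qed

lemma env_sub_eq:
  assumes "subspace H" "\<And>a b. a \<in> H \<Longrightarrow> b \<in> H \<Longrightarrow> bracket a b \<in> H"
  shows "env_sub H = env_proj ` carrier (free_alg H)"
proof -
  have "carrier (env_alg H) = (\<lambda>a. env_ideal H +>\<^bsub>free_alg H\<^esub> a) ` carrier (free_alg H)"
    by (auto simp: env_alg_def FactRing_def A_RCOSETS_def')
  then show ?thesis
    by (simp add: env_sub_def image_image env_map_coset[OF assms])
qed

end

end

theory Submission
  imports Defs
begin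

text \<open>
  By the Jacobi identity, a weight vector \<open>w\<close> of weight \<open>\<lambda>\<close>, \<open>h \<in> H\<close> and \<open>v \<in> L\<close> satisfy
  \<open>[h, [v, w]] = \<lambda>(h) [v, w] + \<lambda>([h, v]) w\<close>. If \<open>w \<noteq> 0\<close>, then \<open>\<lambda>([h, v]) = 0\<close> is therefore
  equivalent to \<open>[h, [v, w]] = \<lambda>(h) [v, w]\<close>. For \<open>v \<in> H\<close> the latter always holds, because
  \<open>[v, w] = \<lambda>(v) w\<close>, so \<open>\<lambda>\<close> vanishes on \<open>[H, H]\<close>; for \<open>v = x\<close> it says that \<open>[x, w]\<close> again has
  weight \<open>\<lambda>\<close>. All of this takes place in \<open>U(L)\<close>, so PBW is not needed.
\<close>

section \<open>Commutators and monomials in the free algebra\<close>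

definition commutator :: "'a::ring \<Rightarrow> 'a \<Rightarrow> 'a" where
  "commutator a b = a * b - b * a"

text \<open>The Leibniz rule: bracketing with \<open>a\<close> is a derivation, so on a word it is
  computed letter by letter.\<close>

lemma commutator_mult_right:
  "commutator a (b * c) = commutator a b * c + b * commutator a c"
  by (simp add: commutator_def algebra_simps)

lemma commutator_add_right: "commutator a (b + c) = commutator a b + commutator a c"
  by (simp add: commutator_def algebra_simps)

lemma carrier_free_alg_UNIV [simp]:
  "carrier (free_alg UNIV :: ('l word \<Rightarrow>\<^sub>0 'k::field) ring) = UNIV"
  by (simp add: free_alg_def)

lemma zero_in_free_alg: "0 \<in> carrier (free_alg G)"
  by (simp add: free_alg_def)

lemma add_in_free_alg:
  "a \<in> carrier (free_alg G) \<Longrightarrow> b \<in> carrier (free_alg G) \<Longrightarrow> a + b \<in> carrier (free_alg G)"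
  using Poly_Mapping.keys_add[of a b] by (auto simp: free_alg_def)

lemma scalar_mult_scalar: "scalar r * scalar s = scalar (r * s)"
  by (simp add: scalar_def mult_single)

lemma poly_mapping_eq_sum_single:
  "a = (\<Sum>k\<in>Poly_Mapping.keys a. Poly_Mapping.single k (Poly_Mapping.lookup a k))"
  by (rule poly_mapping_eqI)
     (simp add: lookup_sum lookup_single when_def not_in_keys_iff_lookup_eq_zero)

text \<open>Every element is the finite sum of its monomials, and all of these use only letters from
  \<open>G\<close>. Additive properties therefore need checking only on single words, where
  induction on the list of letters is available.\<close>

lemma free_alg_induct [consumes 1, case_names zero add word]:
  assumes a: "a \<in> carrier (free_alg G)"
    and zero: "P 0"
    and add: "\<And>a b. a \<in> carrier (free_alg G) \<Longrightarrow> b \<in> carrier (free_alg G) \<Longrightarrow>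
      P a \<Longrightarrow> P b \<Longrightarrow> P (a + b)"
    and word: "\<And>l c. set l \<subseteq> G \<Longrightarrow> P (Poly_Mapping.single (Word l) c)"
  shows "P a"
proof -
  let ?s = "\<lambda>A. \<Sum>k\<in>A. Poly_Mapping.single k (Poly_Mapping.lookup a k)"
  have "?s A \<in> carrier (free_alg G) \<and> P (?s A)"
    if "finite A" "A \<subseteq> Poly_Mapping.keys a" for A
    using that
  proof (induction A)
    case empty
    show ?case by (simp add: zero zero_in_free_alg)
  next
    case (insert k A)
    have "set (letters k) \<subseteq> G"
      using a insert.prems by (simp add: free_alg_def)
    then have "Poly_Mapping.single k (Poly_Mapping.lookup a k) \<in> carrier (free_alg G)"
      and "P (Poly_Mapping.single k (Poly_Mapping.lookup a k))"
      using word[of "letters k"] by (auto simp: free_alg_def)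
    then show ?case
      using insert by (auto intro: add add_in_free_alg)
  qed
  from this[of "Poly_Mapping.keys a"] show ?thesis
    using poly_mapping_eq_sum_single[of a] by simp
qed

lemma scalar_commute: "a * scalar r = scalar r * a"
proof -
  have "a \<in> carrier (free_alg UNIV)"
    by simp
  then show ?thesis
    by (induction a rule: free_alg_induct)
       (simp_all add: distrib_left distrib_right scalar_def mult_single mult.commute)
qed

lemma commutator_scalar_right: "commutator a (scalar r) = 0"
  by (simp add: commutator_def scalar_commute)

lemma commutator_scalar_mult_right: "commutator a (scalar r * b) = scalar r * commutator a b"
  by (simp add: commutator_mult_right commutator_scalar_right)

lemma single_Word_Cons:
  "Poly_Mapping.single (Word (h # l)) c = gen h * Poly_Mapping.single (Word l) c"
  by (simp add: gen_def mult_single plus_word_def)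

section \<open>Congruence modulo the defining ideal of U(L)\<close>

context lie_algebra
begin

text \<open>This is equality in U(L) expressed on representatives. Calculations can then use the
  type class ring operations of the free algebra instead of coset operations.\<close>

definition cong :: "('l word \<Rightarrow>\<^sub>0 'k) \<Rightarrow> ('l word \<Rightarrow>\<^sub>0 'k) \<Rightarrow> bool" (infix \<open>\<sim>\<close> 50)
  where "a \<sim> b \<longleftrightarrow> a - b \<in> env_ideal UNIV"

lemma uminus_free_alg: "\<ominus>\<^bsub>free_alg UNIV\<^esub> a = - a" for a :: "'l word \<Rightarrow>\<^sub>0 'k"
  by (rule abelian_group.minus_equality[OF abelian_group_free_alg]) (simp_all add: free_alg_def)

lemma env_ideal_zero: "0 \<in> env_ideal UNIV"
  and env_ideal_add: "a \<in> env_ideal UNIV \<Longrightarrow> b \<in> env_ideal UNIV \<Longrightarrow> a + b \<in> env_ideal UNIV"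
  and env_ideal_uminus: "a \<in> env_ideal UNIV \<Longrightarrow> - a \<in> env_ideal UNIV"
  and env_ideal_mult_left: "a \<in> env_ideal UNIV \<Longrightarrow> c * a \<in> env_ideal UNIV"
  and env_ideal_mult_right: "a \<in> env_ideal UNIV \<Longrightarrow> a * c \<in> env_ideal UNIV"
proof -
  interpret I: ideal "env_ideal UNIV" "free_alg UNIV" by (rule ideal_env_ideal_UNIV)
  show "0 \<in> env_ideal UNIV"
    using additive_subgroup.zero_closed[OF I.is_additive_subgroup] by (simp add: free_alg_def)
  show "a + b \<in> env_ideal UNIV" if "a \<in> env_ideal UNIV" "b \<in> env_ideal UNIV"
    using additive_subgroup.a_closed[OF I.is_additive_subgroup that] by (simp add: free_alg_def)
  show "- a \<in> env_ideal UNIV" if "a \<in> env_ideal UNIV"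
    using additive_subgroup.a_inv_closed[OF I.is_additive_subgroup that]
    by (simp add: uminus_free_alg)
  show "c * a \<in> env_ideal UNIV" "a * c \<in> env_ideal UNIV" if "a \<in> env_ideal UNIV"
    using I.I_l_closed[OF that, of c] I.I_r_closed[OF that, of c] by (simp_all add: free_alg_def)
qed

lemma cong_refl: "a \<sim> a"
  by (simp add: cong_def env_ideal_zero)

lemma cong_sym: "a \<sim> b \<Longrightarrow> b \<sim> a"
  using env_ideal_uminus[of "a - b"] by (simp add: cong_def)

lemma cong_trans [trans]: "a \<sim> b \<Longrightarrow> b \<sim> c \<Longrightarrow> a \<sim> c"
  using env_ideal_add[of "a - b" "b - c"] by (simp add: cong_def)

lemma cong_add: "a \<sim> b \<Longrightarrow> c \<sim> d \<Longrightarrow> a + c \<sim> b + d"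
  using env_ideal_add[of "a - b" "c - d"] by (simp add: cong_def algebra_simps)

lemma cong_diff: "a \<sim> b \<Longrightarrow> c \<sim> d \<Longrightarrow> a - c \<sim> b - d"
  using env_ideal_add[OF _ env_ideal_uminus, of "a - b" "c - d"] by (simp add: cong_def algebra_simps)

lemma cong_mult: "a \<sim> b \<Longrightarrow> c \<sim> d \<Longrightarrow> a * c \<sim> b * d"
  \<comment> \<open>The identity behind this is
    \<open>a * c - b * d = (a - b) * c + b * (c - d)\<close>.\<close>
  using env_ideal_add[OF env_ideal_mult_right[of "a - b" c] env_ideal_mult_left[of "c - d" b]]
  by (simp add: cong_def algebra_simps)

lemma cong_commutator: "a \<sim> b \<Longrightarrow> c \<sim> d \<Longrightarrow> commutator a c \<sim> commutator b d"
  unfolding commutator_def by (intro cong_diff cong_mult)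

lemma commutator_gen_gen_cong: "commutator (gen a) (gen b) \<sim> gen (bracket a b)"
proof -
  have "env_rels UNIV \<subseteq> env_ideal UNIV"
    unfolding env_ideal_def
    by (intro ring.genideal_self[OF ring_free_alg] env_rels_in_free_alg) auto
  moreover have "commutator (gen a) (gen b) - gen (bracket a b) \<in> env_rels UNIV"
    by (auto simp: env_rels_def commutator_def)
  ultimately show ?thesis
    unfolding cong_def by blast
qed

section \<open>Translation between cosets and representatives\<close>

lemma env_proj_eq_iff: "env_proj a = env_proj b \<longleftrightarrow> a \<sim> b"
proof -
  have mem: "z \<in> env_proj c \<longleftrightarrow> z \<sim> c" for z c
  proof
    show "z \<sim> c" if "z \<in> env_proj c"
      using that by (auto simp: cong_def env_proj_def a_r_coset_def' free_alg_def)
    show "z \<in> env_proj c" if "z \<sim> c"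
      using that
      by (auto simp: cong_def env_proj_def a_r_coset_def' free_alg_def intro!: bexI[of _ "z - c"])
  qed
  show ?thesis
    using mem cong_refl cong_sym cong_trans by blast
qed

lemma env_proj_ring_hom_ring: "ring_hom_ring (free_alg UNIV) (env_alg UNIV) env_proj"
  using ideal.rcos_ring_hom_ring[OF ideal_env_ideal_UNIV]
  by (simp add: env_alg_def env_proj_def[abs_def])

lemma env_proj_zero: "env_proj 0 = \<zero>\<^bsub>env_alg UNIV\<^esub>"
  and env_proj_mult: "env_proj (a * b) = env_proj a \<otimes>\<^bsub>env_alg UNIV\<^esub> env_proj b"
  and env_proj_diff: "env_proj (a - b) = env_proj a \<ominus>\<^bsub>env_alg UNIV\<^esub> env_proj b"
proof -
  interpret h: ring_hom_ring "free_alg UNIV" "env_alg UNIV" env_proj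
    by (rule env_proj_ring_hom_ring)
  have ops: "\<zero>\<^bsub>free_alg UNIV\<^esub> = 0" "c \<otimes>\<^bsub>free_alg UNIV\<^esub> d = c * d"
    "c \<oplus>\<^bsub>free_alg UNIV\<^esub> d = c + d"
    for c d :: "'l word \<Rightarrow>\<^sub>0 'k"
    by (simp_all add: free_alg_def)
  show "env_proj 0 = \<zero>\<^bsub>env_alg UNIV\<^esub>"
    using h.hom_zero by (simp add: ops)
  show "env_proj (a * b) = env_proj a \<otimes>\<^bsub>env_alg UNIV\<^esub> env_proj b"
    using h.hom_mult[of a b] by (simp add: ops)
  show "env_proj (a - b) = env_proj a \<ominus>\<^bsub>env_alg UNIV\<^esub> env_proj b"
    using h.hom_add[of a "- b"] h.hom_a_inv[of b] by (simp add: ops uminus_free_alg a_minus_def)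
qed

lemma env_scale_proj: "env_scale r (env_proj a) = env_proj (scalar r * a)"
  by (simp add: env_scale_def env_proj_mult)

lemma env_commutator_proj: "env_commutator (env_proj a) (env_proj b) = env_proj (commutator a b)"
  by (simp add: env_commutator_def commutator_def env_proj_diff env_proj_mult)

lemma env_proj_in_weight_space_iff:
  assumes "a \<in> carrier (free_alg H)" "subspace H" "\<And>a b. a \<in> H \<Longrightarrow> b \<in> H \<Longrightarrow> bracket a b \<in> H"
  shows "env_proj a \<in> weight_space H lam \<longleftrightarrow>
    (\<forall>h\<in>H. commutator (gen h) a \<sim> scalar (lam h) * a)"
  using assms(1) env_sub_eq[OF assms(2,3)]
  by (auto simp: weight_space_def env_incl_def env_commutator_proj env_scale_proj env_proj_eq_iff)

section \<open>The adjoint action on U(H) and on weight vectors\<close>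

text \<open>The derivation ad x sends each letter \<open>h\<close> to \<open>bracket x h\<close>,
  again in \<open>H\<close>, so by the Leibniz rule it preserves the image of U(H) in U(L). A new
  representative \<open>b\<close> is needed because \<open>commutator (gen x) a\<close> may itself
  contain the letter \<open>x\<close>.\<close>

lemma commutator_gen_in_free_alg:
  assumes ideal: "\<And>h. h \<in> H \<Longrightarrow> bracket x h \<in> H" and a: "a \<in> carrier (free_alg H)"
  shows "\<exists>b\<in>carrier (free_alg H). commutator (gen x) a \<sim> b"
  using a
proof (induction a rule: free_alg_induct)
  case zero
  show ?case
    by (rule bexI[of _ 0]) (simp_all add: commutator_def zero_in_free_alg cong_refl)
next
  case (add a b)
  then obtain a' b' where "a' \<in> carrier (free_alg H)" "commutator (gen x) a \<sim> a'"
    and "b' \<in> carrier (free_alg H)" "commutator (gen x) b \<sim> b'"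
    by auto
  then show ?case
    unfolding commutator_add_right by (intro bexI[of _ "a' + b'"] cong_add add_in_free_alg)
next
  case (word l c)
  then show ?case
  proof (induction l)
    case Nil
    have "Poly_Mapping.single (Word []) c = (scalar c :: 'l word \<Rightarrow>\<^sub>0 'k)"
      by (simp add: scalar_def zero_word_def)
    then show ?case
      by (intro bexI[of _ 0]) (simp_all add: commutator_scalar_right zero_in_free_alg cong_refl)
  next
    case (Cons h l)
    let ?w = "Poly_Mapping.single (Word l) c"
    from Cons obtain b where b: "b \<in> carrier (free_alg H)" "commutator (gen x) ?w \<sim> b"
      by auto
    have h: "h \<in> H" and w: "?w \<in> carrier (free_alg H)"
      using Cons.prems by (auto simp: free_alg_def)
    show ?case
    proof (rule bexI)
      show "commutator (gen x) (Poly_Mapping.single (Word (h # l)) c) \<sim>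
          gen (bracket x h) * ?w + gen h * b"
        unfolding single_Word_Cons commutator_mult_right
        by (intro cong_add cong_mult commutator_gen_gen_cong b cong_refl)
      show "gen (bracket x h) * ?w + gen h * b \<in> carrier (free_alg H)"
        by (intro add_in_free_alg mult_in_free_alg gen_in_free_alg ideal h w b)
    qed
  qed
qed

text \<open>The Jacobi identity for associative commutators moves \<open>gen h\<close> past
  \<open>gen v\<close>; the weight condition and the centrality of scalars then give the first
  summand.\<close>

lemma weight_vector_commutator:
  assumes "commutator (gen h) a \<sim> scalar r * a"
  shows "commutator (gen h) (commutator (gen v) a) \<sim>
    scalar r * commutator (gen v) a + commutator (gen (bracket h v)) a"
proof -
  have jacobi: "commutator (gen h) (commutator (gen v) a) =
      commutator (gen v) (commutator (gen h) a) + commutator (commutator (gen h) (gen v)) a"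
    by (simp add: commutator_def algebra_simps)
  show ?thesis
    unfolding jacobi commutator_scalar_mult_right[symmetric]
    by (intro cong_add cong_commutator cong_refl commutator_gen_gen_cong assms)
qed

text \<open>A nonzero scalar is invertible, so it cannot annihilate a nonzero element of
  U(L).\<close>

lemma scalar_mult_cong_zero:
  assumes "scalar r * a \<sim> 0" "\<not> a \<sim> 0"
  shows "r = 0"
proof (rule ccontr)
  assume "r \<noteq> 0"
  then have "scalar (inverse r) * (scalar r * a) = a"
    by (simp add: mult.assoc[symmetric] scalar_mult_scalar) (simp add: scalar_def)
  then show False
    using assms env_ideal_mult_left[of "scalar r * a" "scalar (inverse r)"]
    by (simp add: cong_def)
qed

text \<open>The obstruction to the bracket of \<open>v\<close> with \<open>a\<close> having
  eigenvalue \<open>r\<close> under \<open>h\<close> is exactly the term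
  \<open>scalar s * a\<close>, which vanishes in U(L) only for \<open>s = 0\<close>.\<close>

lemma weight_vector_commutator_iff:
  assumes "commutator (gen h) a \<sim> scalar r * a"
    and "commutator (gen (bracket h v)) a \<sim> scalar s * a" and "\<not> a \<sim> 0"
  shows "commutator (gen h) (commutator (gen v) a) \<sim> scalar r * commutator (gen v) a \<longleftrightarrow> s = 0"
    (is "?A \<sim> ?B \<longleftrightarrow> _")
proof -
  have "?A \<sim> ?B + scalar s * a"
    using weight_vector_commutator[OF assms(1)] cong_add[OF cong_refl assms(2)] cong_trans by blast
  moreover have "?B + scalar s * a \<sim> ?B \<longleftrightarrow> s = 0"
    using scalar_mult_cong_zero[of s a] assms(3) by (auto simp: cong_def scalar_def env_ideal_zero)
  ultimately show ?thesis
    using cong_sym cong_trans by blast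
qed

text \<open>Since \<open>lam\<close> is linear only on \<open>H\<close>, its kernel is formed inside
  \<open>H\<close>; that kernel is a subspace containing \<open>S\<close>, hence also
  \<open>span S\<close>.\<close>

lemma linear_form_on_zero_span:
  assumes lin: "linear_form_on H lam" and H: "subspace H" and S: "S \<subseteq> H"
    and zero: "\<And>v. v \<in> S \<Longrightarrow> lam v = 0" and v: "v \<in> span S"
  shows "lam v = 0"
proof -
  have "subspace {v \<in> H. lam v = 0}"
  proof (rule subspaceI)
    show "0 \<in> {v \<in> H. lam v = 0}"
      using lin subspace_0[OF H]
      by (auto simp: linear_form_on_def) (metis mult_zero_left scale_zero_left)
  qed (use lin H in \<open>auto simp: linear_form_on_def subspace_add subspace_scale\<close>)
  with S zero v show ?thesis
    using span_minimal[of S "{v \<in> H. lam v = 0}"] by blast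
qed

section \<open>Vanishing on the derived algebra versus ad x stability\<close>

theorem ad_stable_weight_space_iff:
  assumes ideal: "lie_ideal H" and UNIV: "UNIV = {scale c x + h | c h. h \<in> H}"
    and lin: "linear_form_on H lam" and weight: "weight_space H lam \<noteq> {\<zero>\<^bsub>env_alg UNIV\<^esub>}"
  shows "(\<forall>v\<in>derived_algebra. lam v = 0) \<longleftrightarrow> ad_stable x (weight_space H lam)"
proof -
  have H: "subspace H" and br: "\<And>a h. h \<in> H \<Longrightarrow> bracket a h \<in> H"
    using ideal by (auto simp: lie_ideal_def)
  note mem = env_proj_in_weight_space_iff[OF _ H br]
  have anti: "bracket a b = - bracket b a" for a b
  proof -
    have "bracket a (a + b) + bracket b (a + b) = 0"
      using bracket_self[of "a + b"] by (simp only: bracket_add_left)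
    then show ?thesis
      by (simp add: bracket_add_right bracket_self eq_neg_iff_add_eq_0)
  qed
  have br': "bracket h a \<in> H" if "h \<in> H" for a h
    using br[OF that] anti[of h a] subspace_neg[OF H] by simp
  show ?thesis
  proof
    assume *: "\<forall>v\<in>derived_algebra. lam v = 0"
    have lam0: "lam (bracket a b) = 0" for a b
      using * by (auto simp: derived_algebra_def intro: span_base)
    show "ad_stable x (weight_space H lam)"
      unfolding ad_stable_def
    proof
      fix w assume w: "w \<in> weight_space H lam"
      then obtain a where a: "a \<in> carrier (free_alg H)" "w = env_proj a"
        using env_sub_eq[OF H br] by (auto simp: weight_space_def)
      have wt: "commutator (gen h) a \<sim> scalar (lam h) * a" if "h \<in> H" for h
        using w that mem[OF a(1)] by (simp add: a(2))
      \<comment> \<open>Weight vectors must lie in \<open>env_sub H\<close>, so the bracket is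
        replaced by a representative whose letters are in \<open>H\<close>.\<close>
      obtain b where b: "b \<in> carrier (free_alg H)" "commutator (gen x) a \<sim> b"
        using commutator_gen_in_free_alg[OF br a(1)] by blast
      have "commutator (gen h) b \<sim> scalar (lam h) * b" if h: "h \<in> H" for h
      proof -
        have "commutator (gen h) b \<sim> commutator (gen h) (commutator (gen x) a)"
          by (rule cong_commutator[OF cong_refl cong_sym[OF b(2)]])
        also have "\<dots> \<sim> scalar (lam h) * commutator (gen x) a + commutator (gen (bracket h x)) a"
          by (rule weight_vector_commutator[OF wt[OF h]])
        also have "\<dots> \<sim> scalar (lam h) * b + scalar (lam (bracket h x)) * a"
          by (intro cong_add cong_mult cong_refl b wt br' h)
        finally show ?thesis
          by (simp add: lam0 scalar_def)
      qed
      with b(1) have "env_proj b \<in> weight_space H lam"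
        by (simp add: mem)
      moreover have "env_commutator (env_incl x) w = env_proj b"
        using b(2) by (simp add: a(2) env_incl_def env_commutator_proj env_proj_eq_iff)
      ultimately show "env_commutator (env_incl x) w \<in> weight_space H lam"
        by simp
    qed
  next
    assume stable: "ad_stable x (weight_space H lam)"
    \<comment> \<open>Zero always satisfies the weight condition, so a weight space other than the
      zero space contains a nonzero vector.\<close>
    have "env_proj 0 \<in> weight_space H lam"
      by (subst mem) (simp_all add: zero_in_free_alg commutator_def cong_refl)
    then obtain w where w: "w \<in> weight_space H lam" "w \<noteq> \<zero>\<^bsub>env_alg UNIV\<^esub>"
      using weight env_proj_zero by auto
    then obtain a where a: "a \<in> carrier (free_alg H)" "w = env_proj a"
      using env_sub_eq[OF H br] by (auto simp: weight_space_def)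
    have wt: "commutator (gen h) a \<sim> scalar (lam h) * a" if "h \<in> H" for h
      using w(1) that mem[OF a(1)] by (simp add: a(2))
    have nz: "\<not> a \<sim> 0"
      using w(2) env_proj_eq_iff[of a 0] by (simp add: a(2) env_proj_zero)
    \<comment> \<open>Both \<open>h\<close> and \<open>k\<close> act on \<open>a\<close> by scalars,
      and these commute. Hence the bracket of \<open>k\<close> with \<open>a\<close> again has
      eigenvalue \<open>lam h\<close> under \<open>h\<close>, which is the left side of
      \<open>weight_vector_commutator_iff\<close>.\<close>
    have HH: "lam (bracket h k) = 0" if h: "h \<in> H" and k: "k \<in> H" for h k
    proof -
      have "commutator (gen h) (commutator (gen k) a) \<sim> commutator (gen h) (scalar (lam k) * a)"
        by (rule cong_commutator[OF cong_refl wt[OF k]])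
      also have "\<dots> = scalar (lam k) * commutator (gen h) a"
        by (rule commutator_scalar_mult_right)
      also have "\<dots> \<sim> scalar (lam k) * (scalar (lam h) * a)"
        by (rule cong_mult[OF cong_refl wt[OF h]])
      also have "\<dots> = scalar (lam h) * (scalar (lam k) * a)"
        by (simp add: mult.assoc[symmetric] scalar_mult_scalar mult.commute)
      also have "\<dots> \<sim> scalar (lam h) * commutator (gen k) a"
        by (rule cong_mult[OF cong_refl cong_sym[OF wt[OF k]]])
      finally show ?thesis
        using weight_vector_commutator_iff[OF wt[OF h] wt[OF br[OF k]] nz] by simp
    qed
    have Hx: "lam (bracket h x) = 0" if h: "h \<in> H" for h
    proof -
      \<comment> \<open>Stability enters here: it supplies the eigenvalue condition of
        \<open>weight_vector_commutator_iff\<close> for \<open>v = x\<close>.\<close>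
      have "env_proj (commutator (gen x) a) \<in> weight_space H lam"
        using stable w(1) by (auto simp: ad_stable_def a(2) env_incl_def env_commutator_proj)
      then have "env_commutator (env_incl h) (env_proj (commutator (gen x) a)) =
          env_scale (lam h) (env_proj (commutator (gen x) a))"
        using h by (simp add: weight_space_def)
      then have "commutator (gen h) (commutator (gen x) a) \<sim> scalar (lam h) * commutator (gen x) a"
        by (simp add: env_incl_def env_commutator_proj env_scale_proj env_proj_eq_iff)
      then show ?thesis
        using weight_vector_commutator_iff[OF wt[OF h] wt[OF br'[OF h]] nz] by simp
    qed
    \<comment> \<open>Membership in \<open>H\<close> is proved together with vanishing, because
      \<open>lam\<close> extends linearly to the span only within \<open>H\<close>.\<close>
    have *: "bracket a b \<in> H \<and> lam (bracket a b) = 0" for a b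
    proof -
      obtain c h d k where hk: "h \<in> H" "k \<in> H" and ab: "a = scale c x + h" "b = scale d x + k"
        using UNIV by blast
      \<comment> \<open>The x-x term vanishes, and antisymmetry turns the bracket of
        \<open>x\<close> with \<open>k\<close> around, which gives the coefficient
        \<open>- c\<close>.\<close>
      have "bracket a b = bracket h k + scale d (bracket h x) + scale (- c) (bracket k x)"
        by (simp add: ab bracket_add_left bracket_add_right bracket_scale_left bracket_scale_right
            bracket_self anti[of x k])
      moreover have "bracket h k \<in> H" "scale d (bracket h x) \<in> H" "scale (- c) (bracket k x) \<in> H"
        using hk by (auto intro: br' subspace_scale[OF H] subspace_neg[OF H])
      moreover have "lam (scale r (bracket h x)) = 0" if "h \<in> H" for r h
        using lin that br' Hx by (simp add: linear_form_on_def)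
      ultimately show ?thesis
        using lin HH[OF hk] hk subspace_add[OF H]
        by (simp add: linear_form_on_def del: scale_minus_left)
    qed
    show "\<forall>v\<in>derived_algebra. lam v = 0"
    proof
      fix v assume "v \<in> derived_algebra"
      then show "lam v = 0"
        unfolding derived_algebra_def
        by (rule linear_form_on_zero_span[OF lin H, rotated 2]) (use * in blast)+
    qed
  qed
qed

end

theorem proposition2p6:
  fixes scale :: "'k::alg_closed_field \<Rightarrow> 'l::ab_group_add \<Rightarrow> 'l"
    and bracket :: "'l \<Rightarrow> 'l \<Rightarrow> 'l"
    and Basis :: "'l set"
    and p :: nat
    and x :: 'l
    and H :: "'l set"
    and lam :: "'l \<Rightarrow> 'k"
  assumes "lie_algebra scale bracket"
    and "finite_dimensional_vector_space scale Basis"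
    and "CHAR('k) = p" and "p > 0"
    and "lie_algebra.lie_ideal scale bracket H"
    and "vector_space.dim scale H + 1 = vector_space.dim scale UNIV"
    and "UNIV = {scale c x + h | c h. h \<in> H}"
    and "lie_algebra.linear_form_on scale H lam"
    and "lie_algebra.weight_space scale bracket H lam \<noteq> {\<zero>\<^bsub>lie_algebra.env_alg scale bracket UNIV\<^esub>}"
  shows "(\<forall>v\<in>lie_algebra.derived_algebra scale bracket. lam v = 0) \<longleftrightarrow>
         lie_algebra.ad_stable scale bracket x (lie_algebra.weight_space scale bracket H lam)"
  using assms(1,5,7,8,9) by (rule lie_algebra.ad_stable_weight_space_iff)

end
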